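(* Let $\bm{A}$ be a $\{-1,1\}^p$-valued random vector and $B$ a $\{-1,1\}$-valued random variable on a common probability space, where $\mathbf{E}[\bm{A}^{\otimes}\bm{A}^{\otimes\top}]$ is positive definite, and let $\bm{\beta}\in\mathbb{R}^{2^p}$ be the unique vector with $\mathbf{E}[B\mid\bm{A}]=\bm{\beta}^\top\bm{A}^{\otimes}$. Then the following are equivalent: 1. $\|\bm{\beta}\|_2=1$. 2. $\bm{\beta}$ is a vertex of the hypercube $\{\bm{x}\in\mathbb{R}^{2^p}:\|\mathbf{H}_{2^p}\bm{x}\|_\infty\le 1\}$. 3. $B=\mathbf{E}[B\mid\bm{A}]=\bm{\beta}^\top\bm{A}^{\otimes}$ (almost surely). In particular, in the case of 3, $\mathrm{Var}(B)=\mathrm{Var}(\bm{\beta}^\top\bm{A}^{\otimes})=\mathrm{Var}(\mathbf{E}[B\mid\bm{A}])$.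
   Context: For $\bm{A}\in\{-1,1\}^p$, $\bm{A}^{\otimes}=\begin{pmatrix}1\\ A_1\end{pmatrix}\otimes\cdots\otimes\begin{pmatrix}1\\ A_p\end{pmatrix}\in\{-1,1\}^{2^p}$. $\mathbf{H}_{2^p}$ is the Sylvester Hadamard matrix ($\mathbf{H}_1=(1)$, $\mathbf{H}_{2m}=\begin{pmatrix}\mathbf{H}_m&\mathbf{H}_m\\ \mathbf{H}_m&-\mathbf{H}_m\end{pmatrix}$), whose rows are the $2^p$ possible values of $\bm{A}^{\otimes}$. *)

theory Defs
  imports "HOL-Probability.Probability" "Jordan_Normal_Form.Matrix"
begin

hide_const (open) Finite_Cartesian_Product.vec Finite_Cartesian_Product.mat
  Finite_Cartesian_Product.row Finite_Cartesian_Product.column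
hide_type (open) Finite_Cartesian_Product.vec
no_notation Inner_Product.real_inner_class.inner (infix \<open>\<bullet>\<close> 70)
no_notation Finite_Cartesian_Product.vec_nth (infixl \<open>$\<close> 90)

text \<open>Vectors and matrices are those of \<^theory>\<open>Jordan_Normal_Form.Matrix\<close>, since the size \<open>2 ^ p\<close>
  varies in the recursions below. Indices start at 0.\<close>

definition sign_vecs :: "nat \<Rightarrow> real vec set" where
  "sign_vecs p = {a \<in> carrier_vec p. \<forall>i<p. a $ i \<in> {-1, 1}}"

text \<open>Kronecker product of column vectors: \<open>u \<otimes> v\<close> is the concatenation of the blocks \<open>u\<^sub>i v\<close>.\<close>

definition kron_vec :: "real vec \<Rightarrow> real vec \<Rightarrow> real vec" where
  "kron_vec u v =
     vec (dim_vec u * dim_vec v) (\<lambda>k. u $ (k div dim_vec v) * v $ (k mod dim_vec v))"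

text \<open>\<open>tensor_vec a = (1, a\<^sub>1)\<^sup>T \<otimes> \<dots> \<otimes> (1, a\<^sub>p)\<^sup>T\<close>; the seed is the empty product \<open>(1)\<close>.\<close>

definition tensor_vec :: "real vec \<Rightarrow> real vec" where
  "tensor_vec a =
     foldr (\<lambda>i. kron_vec (vec_of_list [1, a $ i])) [0..<dim_vec a] (vec_of_list [1])"

text \<open>\<open>sylvester p\<close> is the Sylvester Hadamard matrix of order \<open>2 ^ p\<close>.\<close>

fun sylvester :: "nat \<Rightarrow> real mat" where
  "sylvester 0 = 1\<^sub>m 1"
| "sylvester (Suc p) =
     four_block_mat (sylvester p) (sylvester p) (sylvester p) (- sylvester p)"

text \<open>The matrix \<open>E[X X\<^sup>T]\<close> for a random vector \<open>X\<close> with \<open>n\<close> entries.\<close>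

definition second_moment_mat :: "'a measure \<Rightarrow> nat \<Rightarrow> ('a \<Rightarrow> real vec) \<Rightarrow> real mat" where
  "second_moment_mat M n X = mat n n (\<lambda>(i, j). \<integral>\<omega>. X \<omega> $ i * X \<omega> $ j \<partial>M)"

definition pos_def_mat :: "real mat \<Rightarrow> bool" where
  "pos_def_mat S \<longleftrightarrow> square_mat S \<and> transpose_mat S = S \<and>
     (\<forall>x \<in> carrier_vec (dim_row S). x \<noteq> 0\<^sub>v (dim_row S) \<longrightarrow> 0 < x \<bullet> (S *\<^sub>v x))"

definition l2_norm :: "real vec \<Rightarrow> real" where
  "l2_norm x = sqrt (\<Sum>i<dim_vec x. (x $ i)\<^sup>2)"

text \<open>Only meant for vectors of positive dimension.\<close>

definition linf_norm :: "real vec \<Rightarrow> real" where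
  "linf_norm x = (MAX i\<in>{..<dim_vec x}. \<bar>x $ i\<bar>)"

definition hadamard_cube :: "nat \<Rightarrow> real vec set" where
  "hadamard_cube p = {x \<in> carrier_vec (2 ^ p). linf_norm (sylvester p *\<^sub>v x) \<le> 1}"

text \<open>A vertex is an extreme point. This is the definition of \<^const>\<open>extreme_point_of\<close>, which is not
  available on \<^typ>\<open>real vec\<close> because that type is not a real vector space.\<close>

definition vertex_of :: "real vec \<Rightarrow> real vec set \<Rightarrow> bool" where
  "vertex_of x S \<longleftrightarrow> x \<in> S \<and>
     (\<forall>a \<in> S. \<forall>b \<in> S. \<not> (a \<noteq> b \<and> (\<exists>t. 0 < t \<and> t < 1 \<and> x = (1 - t) \<cdot>\<^sub>v a + t \<cdot>\<^sub>v b)))"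

text \<open>\<open>E[Y | X]\<close> for an \<open>X\<close> with values in the discrete space \<open>S\<close>: conditional expectation with
  respect to the sub-sigma-algebra generated by \<open>X\<close>.\<close>

definition cond_exp_given :: "'a measure \<Rightarrow> 'b set \<Rightarrow> ('a \<Rightarrow> 'b) \<Rightarrow> ('a \<Rightarrow> real) \<Rightarrow> 'a \<Rightarrow> real" where
  "cond_exp_given M S X Y = real_cond_exp M (vimage_algebra (space M) X (count_space S)) Y"

end

theory Submission
  imports Defs
begin

text \<open>All three conditions say that every entry of \<open>H\<beta>\<close> has absolute value 1. Positive definiteness
  forces the tensor vector of \<open>A\<close> to hit every row of \<open>H\<close> with positive probability, so the entries of
  \<open>H\<beta>\<close> are values of \<open>E[B | A]\<close> and lie in \<open>[-1, 1]\<close>. The norm condition is then Parseval's identity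
  \<open>\<parallel>H\<beta>\<parallel>\<^sup>2 = 2\<^sup>p \<parallel>\<beta>\<parallel>\<^sup>2\<close>, the vertex condition holds because \<open>H\<close> is invertible, and condition 3
  because \<open>E[(B - E[B | A])\<^sup>2] = 1 - E[E[B | A]\<^sup>2]\<close>.\<close>

section \<open>The Sylvester matrix and its cube\<close>

lemma sylvester_carrier [simp]: "sylvester p \<in> carrier_mat (2 ^ p) (2 ^ p)"
proof (induction p)
  case (Suc p)
  then show ?case
    using four_block_carrier_mat[OF Suc Suc] by (simp add: mult_2)
qed simp

lemma dim_sylvester [simp]: "dim_row (sylvester p) = 2 ^ p" "dim_col (sylvester p) = 2 ^ p"
  using sylvester_carrier[of p] by (auto simp del: sylvester_carrier)

lemma transpose_sylvester: "transpose_mat (sylvester p) = sylvester p"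
proof (induction p)
  case (Suc p)
  have neg: "transpose_mat (- sylvester p) = - transpose_mat (sylvester p)"
    by (rule eq_matI) auto
  have "transpose_mat (four_block_mat (sylvester p) (sylvester p) (sylvester p) (- sylvester p)) =
    four_block_mat (transpose_mat (sylvester p)) (transpose_mat (sylvester p))
      (transpose_mat (sylvester p)) (transpose_mat (- sylvester p))"
    by (rule transpose_four_block_mat) (auto intro: sylvester_carrier)
  then show ?case
    by (simp add: neg Suc)
qed simp

text \<open>In the block product the off-diagonal blocks cancel and the diagonal blocks each add two
  copies of the smaller square. Together with symmetry this is the Hadamard property.\<close>

lemma sylvester_square: "sylvester p * sylvester p = 2 ^ p \<cdot>\<^sub>m 1\<^sub>m (2 ^ p)"
proof (induction p)
  case (Suc p)
  let ?H = "sylvester p" and ?N = "2 ^ p :: nat"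
  have c: "- ?H \<in> carrier_mat ?N ?N"
    by (simp add: sylvester_carrier)
  have "four_block_mat ?H ?H ?H (- ?H) * four_block_mat ?H ?H ?H (- ?H) =
    four_block_mat (?H * ?H + ?H * ?H) (?H * ?H + ?H * (- ?H))
      (?H * ?H + (- ?H) * ?H) (?H * ?H + (- ?H) * (- ?H))"
    by (rule mult_four_block_mat[OF sylvester_carrier sylvester_carrier sylvester_carrier c
          sylvester_carrier sylvester_carrier sylvester_carrier c])
  also have "\<dots> = 2 ^ Suc p \<cdot>\<^sub>m 1\<^sub>m (2 ^ Suc p)"
    by (rule eq_matI) (auto simp: Suc)
  finally show ?case
    by simp
qed (auto intro: eq_matI)

lemma sylvester_row_carrier [simp]: "row (sylvester p) k \<in> carrier_vec (2 ^ p)"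
  by (metis dim_sylvester(2) row_carrier)

lemma sylvester_mult_carrier [simp]: "sylvester p *\<^sub>v x \<in> carrier_vec (2 ^ p)"
  by (simp add: carrier_vecI)

lemma sylvester_row_eq_col: "k < 2 ^ p \<Longrightarrow> col (sylvester p) k = row (sylvester p) k"
  by (metis col_transpose dim_sylvester(1) transpose_sylvester)

text \<open>By symmetry the columns are the rows, so these scalar products are the entries of the
  square of the matrix.\<close>

lemma sylvester_row_orthogonal:
  assumes "j < 2 ^ p" "k < 2 ^ p"
  shows "row (sylvester p) j \<bullet> row (sylvester p) k = (if j = k then 2 ^ p else 0)"
proof -
  have "row (sylvester p) j \<bullet> col (sylvester p) k = (sylvester p * sylvester p) $$ (j, k)"
    using assms by simp
  then show ?thesis
    using assms by (simp add: sylvester_square sylvester_row_eq_col)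
qed

lemma sylvester_mult_mult:
  assumes "x \<in> carrier_vec (2 ^ p)"
  shows "sylvester p *\<^sub>v (sylvester p *\<^sub>v x) = 2 ^ p \<cdot>\<^sub>v x"
proof -
  have "sylvester p *\<^sub>v (sylvester p *\<^sub>v x) = (sylvester p * sylvester p) *\<^sub>v x"
    by (rule assoc_mult_mat_vec[symmetric, OF sylvester_carrier sylvester_carrier assms])
  then show ?thesis
    using assms by (auto simp: sylvester_square)
qed

text \<open>Symmetry moves one factor H across the scalar product, where it meets the other one, and
  H * H is 2 ^ p times the identity.\<close>

lemma sylvester_parseval:
  assumes "x \<in> carrier_vec (2 ^ p)"
  shows "(\<Sum>k<2 ^ p. ((sylvester p *\<^sub>v x) $ k)\<^sup>2) = 2 ^ p * (l2_norm x)\<^sup>2"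
proof -
  have sq: "v \<bullet> v = (\<Sum>k<2 ^ p. (v $ k)\<^sup>2)" if "v \<in> carrier_vec (2 ^ p)" for v :: "real vec"
    using that by (auto simp: scalar_prod_def power2_eq_square atLeast0LessThan)
  have "(\<Sum>k<2 ^ p. ((sylvester p *\<^sub>v x) $ k)\<^sup>2) = (sylvester p *\<^sub>v x) \<bullet> (sylvester p *\<^sub>v x)"
    by (simp add: sq)
  also have "\<dots> = (sylvester p *\<^sub>v (sylvester p *\<^sub>v x)) \<bullet> x"
    using transpose_vec_mult_scalar[OF sylvester_carrier assms sylvester_mult_carrier]
    by (simp add: transpose_sylvester)
  also have "\<dots> = 2 ^ p * (x \<bullet> x)"
    using assms by (simp add: sylvester_mult_mult)
  also have "x \<bullet> x = (l2_norm x)\<^sup>2"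
    using assms by (auto simp: sq l2_norm_def sum_nonneg)
  finally show ?thesis .
qed

section \<open>The cube: membership, unit norm and vertices\<close>

lemma hadamard_cube_iff:
  "x \<in> hadamard_cube p \<longleftrightarrow>
    x \<in> carrier_vec (2 ^ p) \<and> (\<forall>k<2 ^ p. \<bar>(sylvester p *\<^sub>v x) $ k\<bar> \<le> 1)"
proof -
  have "linf_norm (sylvester p *\<^sub>v x) \<le> 1 \<longleftrightarrow> (\<forall>k<2 ^ p. \<bar>(sylvester p *\<^sub>v x) $ k\<bar> \<le> 1)"
    \<comment> \<open>\<open>Max_le_iff\<close> requires a nonempty index set, which 2 ^ p > 0
      guarantees.\<close>
    unfolding linf_norm_def by (subst Max_le_iff) (auto simp: lessThan_empty_iff)
  then show ?thesis
    by (simp add: hadamard_cube_def)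
qed

text \<open>By Parseval, norm 1 means that the 2 ^ p squared entries of Hx sum to 2 ^ p. In the cube
  each square is at most 1, so the sum is that large only if every square equals 1.\<close>

lemma l2_norm_eq_1_iff:
  assumes "x \<in> hadamard_cube p"
  shows "l2_norm x = 1 \<longleftrightarrow> (\<forall>k<2 ^ p. \<bar>(sylvester p *\<^sub>v x) $ k\<bar> = 1)"
proof -
  define y where "y = sylvester p *\<^sub>v x"
  have le: "(y $ k)\<^sup>2 \<le> 1" if "k < 2 ^ p" for k
    using assms that by (simp add: hadamard_cube_iff y_def abs_square_le_1)
  have "l2_norm x \<ge> 0"
    by (simp add: l2_norm_def sum_nonneg)
  then have "l2_norm x = 1 \<longleftrightarrow> (l2_norm x)\<^sup>2 = 1"
    by (simp add: power2_eq_1_iff)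
  also have "\<dots> \<longleftrightarrow> (\<Sum>k<2 ^ p. (y $ k)\<^sup>2) = 2 ^ p"
    using assms by (simp add: hadamard_cube_iff sylvester_parseval y_def del: index_mult_mat_vec)
  also have "\<dots> \<longleftrightarrow> (\<Sum>k<2 ^ p. 1 - (y $ k)\<^sup>2) = 0"
    by (auto simp: sum_subtractf)
  also have "\<dots> \<longleftrightarrow> (\<forall>k<2 ^ p. (y $ k)\<^sup>2 = 1)"
    using le by (subst sum_nonneg_eq_0_iff) auto
  also have "\<dots> \<longleftrightarrow> (\<forall>k<2 ^ p. \<bar>y $ k\<bar> = 1)"
    by (simp add: abs_square_eq_1)
  finally show ?thesis
    by (simp add: y_def)
qed

text \<open>The points 1 and -1 are extreme in the interval [-1, 1]: a positively weighted sum of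
  nonnegative gaps vanishes only if each gap does.\<close>

lemma convex_combination_extreme:
  fixes a b t :: real
  assumes "0 < t" "t < 1" "\<bar>a\<bar> \<le> 1" "\<bar>b\<bar> \<le> 1" "\<bar>(1 - t) * a + t * b\<bar> = 1"
  shows "a = b"
proof -
  \<comment> \<open>Multiplying by \<open>s\<close>, which is 1 or -1, treats both endpoints at
    once: the gaps are \<open>1 - s * a\<close> and \<open>1 - s * b\<close>.\<close>
  define s where "s = (1 - t) * a + t * b"
  have s: "s = 1 \<or> s = - 1"
    using assms(5) by (auto simp: s_def abs_if split: if_splits)
  have bnd: "s * a \<le> 1" "s * b \<le> 1"
    using s assms(3,4) by auto
  have "(1 - t) * (1 - s * a) + t * (1 - s * b) = 1 - s * s"
    by (simp add: s_def algebra_simps)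
  moreover have "s * s = 1"
    using s by auto
  ultimately have sum0: "(1 - t) * (1 - s * a) + t * (1 - s * b) = 0"
    by simp
  moreover have "0 \<le> (1 - t) * (1 - s * a)" "0 \<le> t * (1 - s * b)"
    using assms(1,2) bnd by simp_all
  ultimately have "(1 - t) * (1 - s * a) = 0" "t * (1 - s * b) = 0"
    by linarith+
  then have "s * a = s * b"
    using assms(1,2) by simp
  then show ?thesis
    using s by auto
qed

text \<open>The cube is the preimage of the standard cube under the invertible H, and the vertices
  of the standard cube are the sign vectors. A coordinate of Hx with slack leaves room for a segment
  around x.\<close>

lemma vertex_hadamard_cube_iff:
  assumes x: "x \<in> hadamard_cube p"
  shows "vertex_of x (hadamard_cube p) \<longleftrightarrow> (\<forall>k<2 ^ p. \<bar>(sylvester p *\<^sub>v x) $ k\<bar> = 1)"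
proof
  assume vert: "vertex_of x (hadamard_cube p)"
  show "\<forall>k<2 ^ p. \<bar>(sylvester p *\<^sub>v x) $ k\<bar> = 1"
  proof (rule ccontr)
    assume "\<not> ?thesis"
    then obtain k where k: "k < 2 ^ p" "\<bar>(sylvester p *\<^sub>v x) $ k\<bar> < 1"
      using x by (force simp: hadamard_cube_iff)
    define d where "d = row (sylvester p) k"
    \<comment> \<open>Moving x by \<open>e\<close> along \<open>d\<close> in either direction shifts
      coordinate k of Hx by exactly its slack, because H stretches \<open>d\<close> by the factor 2
      ^ p.\<close>
    define e where "e = (1 - \<bar>(sylvester p *\<^sub>v x) $ k\<bar>) / 2 ^ p"
    have e: "e > 0"
      using k by (simp add: e_def)
    have xc: "x \<in> carrier_vec (2 ^ p)"
      using x by (simp add: hadamard_cube_iff)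
    have dc: "d \<in> carrier_vec (2 ^ p)"
      by (simp add: d_def)
    \<comment> \<open>Since \<open>H d = 2 ^ p e\<^sub>k\<close>, moving along \<open>d\<close> changes only the slack coordinate of \<open>H x\<close>.\<close>
    have img: "(sylvester p *\<^sub>v (x + s \<cdot>\<^sub>v d)) $ j =
        (sylvester p *\<^sub>v x) $ j + (if j = k then s * 2 ^ p else 0)" if "j < 2 ^ p" for s j
      using that k xc dc
      by (simp add: d_def scalar_prod_add_distrib[of _ "2 ^ p"] sylvester_row_orthogonal)
    have mem: "x + s \<cdot>\<^sub>v d \<in> hadamard_cube p" if "\<bar>s\<bar> = e" for s
    proof -
      have "\<bar>s * 2 ^ p\<bar> = 1 - \<bar>(sylvester p *\<^sub>v x) $ k\<bar>"
        using that by (simp add: abs_mult e_def)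
      then have "\<bar>(sylvester p *\<^sub>v x) $ k + s * 2 ^ p\<bar> \<le> 1"
        by linarith
      then show ?thesis
        using x xc dc by (auto simp: hadamard_cube_iff img simp del: index_mult_mat_vec)
    qed
    have "(sylvester p *\<^sub>v (x + (- e) \<cdot>\<^sub>v d)) $ k \<noteq> (sylvester p *\<^sub>v (x + e \<cdot>\<^sub>v d)) $ k"
      using e k by (simp add: img del: index_mult_mat_vec)
    then have "x + (- e) \<cdot>\<^sub>v d \<noteq> x + e \<cdot>\<^sub>v d"
      by metis
    \<comment> \<open>x is the midpoint of two distinct points of the cube, which contradicts
      extremality.\<close>
    moreover have "x = (1 - 1 / 2) \<cdot>\<^sub>v (x + (- e) \<cdot>\<^sub>v d) + (1 / 2) \<cdot>\<^sub>v (x + e \<cdot>\<^sub>v d)"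
      using xc dc by (intro eq_vecI) (auto simp: algebra_simps)
    moreover have "x + (- e) \<cdot>\<^sub>v d \<in> hadamard_cube p" "x + e \<cdot>\<^sub>v d \<in> hadamard_cube p"
      using e by (auto intro: mem)
    moreover have "0 < (1 / 2 :: real)" "1 / 2 < (1 :: real)"
      by simp_all
    ultimately show False
      using vert unfolding vertex_of_def by blast
  qed
next
  assume ext: "\<forall>k<2 ^ p. \<bar>(sylvester p *\<^sub>v x) $ k\<bar> = 1"
  have "a = b" if a: "a \<in> hadamard_cube p" and b: "b \<in> hadamard_cube p"
    and t: "0 < t" "t < 1" and xab: "x = (1 - t) \<cdot>\<^sub>v a + t \<cdot>\<^sub>v b" for a b t
  proof -
    have c: "a \<in> carrier_vec (2 ^ p)" "b \<in> carrier_vec (2 ^ p)"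
      using a b by (auto simp: hadamard_cube_iff)
    have "(sylvester p *\<^sub>v a) $ k = (sylvester p *\<^sub>v b) $ k" if "k < 2 ^ p" for k
    proof (rule convex_combination_extreme[OF t])
      have "(sylvester p *\<^sub>v x) $ k = (1 - t) * (sylvester p *\<^sub>v a) $ k + t * (sylvester p *\<^sub>v b) $ k"
        using c that by (simp add: xab scalar_prod_add_distrib[of _ "2 ^ p"])
      then show "\<bar>(1 - t) * (sylvester p *\<^sub>v a) $ k + t * (sylvester p *\<^sub>v b) $ k\<bar> = 1"
        using ext that by metis
    qed (use a b that in \<open>auto simp: hadamard_cube_iff simp del: index_mult_mat_vec\<close>)
    then have "sylvester p *\<^sub>v a = sylvester p *\<^sub>v b"
      by (intro eq_vecI) auto
    \<comment> \<open>Injectivity of H: a second application of H returns each vector up to the same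
      factor.\<close>
    then have "2 ^ p \<cdot>\<^sub>v a = 2 ^ p \<cdot>\<^sub>v b"
      using c sylvester_mult_mult by metis
    then have "2 ^ p * a $ i = 2 ^ p * b $ i" if "i < 2 ^ p" for i
      using c that by (metis carrier_vecD index_smult_vec(1))
    then show "a = b"
      using c by (intro eq_vecI) auto
  qed
  then show "vertex_of x (hadamard_cube p)"
    using x unfolding vertex_of_def by blast
qed

section \<open>Tensor vectors as Hadamard rows\<close>

text \<open>Rewrites a Kronecker factor as concatenation, the form in which the rows of the block
  matrix \<open>sylvester (Suc p)\<close> appear.\<close>

lemma kron_vec_pair:
  "kron_vec (vec_of_list [1, c]) v = v @\<^sub>v (c \<cdot>\<^sub>v v)"
proof (rule eq_vecI)
  fix i assume i: "i < dim_vec (v @\<^sub>v (c \<cdot>\<^sub>v v))"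
  show "kron_vec (vec_of_list [1, c]) v $ i = (v @\<^sub>v (c \<cdot>\<^sub>v v)) $ i"
  proof (cases "i < dim_vec v")
    case False
    then have "i div dim_vec v = Suc 0" "i mod dim_vec v = i - dim_vec v"
      using i by (auto simp: div_nat_eqI le_mod_geq)
    then show ?thesis
      using False i by (simp add: kron_vec_def)
  qed (use i in \<open>simp add: kron_vec_def\<close>)
qed (simp add: kron_vec_def)

lemma tensor_vec_vCons:
  "tensor_vec (vCons c a) = tensor_vec a @\<^sub>v (c \<cdot>\<^sub>v tensor_vec a)"
proof -
  have "tensor_vec (vCons c a) = kron_vec (vec_of_list [1, c]) (tensor_vec a)"
    unfolding tensor_vec_def
    \<comment> \<open>The first entry gives the outermost factor; the remaining indices start at 1
      and are shifted down to index \<open>a\<close>.\<close>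
    by (simp add: upt_conv_Cons map_Suc_upt[symmetric] foldr_map comp_def
        del: vec_of_list_Cons upt_Suc)
  then show ?thesis
    by (simp only: kron_vec_pair)
qed

text \<open>The scalar 1 is kept explicit so that both halves match \<open>tensor_vec_vCons\<close>,
  with c = 1 and c = -1.\<close>

lemma row_sylvester_Suc:
  assumes "k < 2 ^ p"
  shows "row (sylvester (Suc p)) k = row (sylvester p) k @\<^sub>v (1 \<cdot>\<^sub>v row (sylvester p) k)"
    and "row (sylvester (Suc p)) (2 ^ p + k) = row (sylvester p) k @\<^sub>v ((-1) \<cdot>\<^sub>v row (sylvester p) k)"
  using assms by (auto intro!: eq_vecI simp: mult_2)

text \<open>The first sign selects the upper or lower half of the matrix, and the remaining signs
  select the row within that half by induction.\<close>

lemma tensor_vec_is_sylvester_row: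
  assumes "a \<in> sign_vecs p"
  shows "\<exists>k<2 ^ p. tensor_vec a = row (sylvester p) k"
  using assms
proof (induction p arbitrary: a)
  case 0
  then show ?case
    by (auto intro!: eq_vecI simp: tensor_vec_def sign_vecs_def)
next
  case (Suc p)
  obtain c b where a: "a = vCons c b"
    using Suc.prems by (cases a) (auto simp: sign_vecs_def)
  have c: "c \<in> {-1, 1}" and b: "b \<in> sign_vecs p"
    using Suc.prems by (fastforce simp: a sign_vecs_def)+
  obtain k where k: "k < 2 ^ p" "tensor_vec b = row (sylvester p) k"
    using Suc.IH[OF b] by blast
  have "tensor_vec a = row (sylvester (Suc p)) (if c = 1 then k else 2 ^ p + k)"
    using c k by (auto simp only: a tensor_vec_vCons row_sylvester_Suc split: if_splits)
  then show ?case
    using k(1) by (intro exI[of _ "if c = 1 then k else 2 ^ p + k"]) simp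
qed

section \<open>Conditional expectation given the sign vector\<close>

text \<open>The square expands into a double sum that is integrated termwise. Positive definiteness
  thereby becomes a statement about the mean square of a linear form in X.\<close>

lemma second_moment_quadratic_form:
  assumes int: "\<And>i j. i < n \<Longrightarrow> j < n \<Longrightarrow> integrable M (\<lambda>\<omega>. X \<omega> $ i * X \<omega> $ j)"
    and X: "\<And>\<omega>. \<omega> \<in> space M \<Longrightarrow> X \<omega> \<in> carrier_vec n" and x: "x \<in> carrier_vec n"
  shows "x \<bullet> (second_moment_mat M n X *\<^sub>v x) = (\<integral>\<omega>. (x \<bullet> X \<omega>)\<^sup>2 \<partial>M)"
proof -
  have "(\<integral>\<omega>. (x \<bullet> X \<omega>)\<^sup>2 \<partial>M) =
      (\<integral>\<omega>. (\<Sum>i<n. \<Sum>j<n. x $ i * (X \<omega> $ i * X \<omega> $ j) * x $ j) \<partial>M)"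
  proof (rule Bochner_Integration.integral_cong)
    fix \<omega> assume "\<omega> \<in> space M"
    then have "x \<bullet> X \<omega> = (\<Sum>i<n. x $ i * X \<omega> $ i)"
      using X by (auto simp: scalar_prod_def atLeast0LessThan dest: carrier_vecD)
    then show "(x \<bullet> X \<omega>)\<^sup>2 = (\<Sum>i<n. \<Sum>j<n. x $ i * (X \<omega> $ i * X \<omega> $ j) * x $ j)"
      by (simp add: power2_eq_square sum_product mult_ac)
  qed simp
  also have "\<dots> = (\<Sum>i<n. \<Sum>j<n. x $ i * (\<integral>\<omega>. X \<omega> $ i * X \<omega> $ j \<partial>M) * x $ j)"
  proof -
    have term_int: "integrable M (\<lambda>\<omega>. x $ i * (X \<omega> $ i * X \<omega> $ j) * x $ j)" if "i < n" "j < n" for i j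
      using int[OF that] by (intro integrable_mult_left integrable_mult_right)
    have "(\<integral>\<omega>. (\<Sum>i<n. \<Sum>j<n. x $ i * (X \<omega> $ i * X \<omega> $ j) * x $ j) \<partial>M) =
        (\<Sum>i<n. \<integral>\<omega>. (\<Sum>j<n. x $ i * (X \<omega> $ i * X \<omega> $ j) * x $ j) \<partial>M)"
      using term_int by (intro Bochner_Integration.integral_sum integrable_sum) auto
    also have "\<dots> = (\<Sum>i<n. \<Sum>j<n. \<integral>\<omega>. x $ i * (X \<omega> $ i * X \<omega> $ j) * x $ j \<partial>M)"
      using term_int by (intro sum.cong refl Bochner_Integration.integral_sum) auto
    finally show ?thesis
      by simp
  qed
  also have "\<dots> = x \<bullet> (second_moment_mat M n X *\<^sub>v x)"
    using x by (auto simp: second_moment_mat_def scalar_prod_def atLeast0LessThan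
        sum_distrib_left mult_ac intro!: sum.cong)
  finally show ?thesis
    by simp
qed

locale random_signs = prob_space M for M :: "'a measure" +
  fixes p :: nat and A :: "'a \<Rightarrow> real vec"
  assumes A [measurable]: "A \<in> measurable M (count_space (sign_vecs p))"
begin

lemma tensor_row:
  assumes "\<omega> \<in> space M"
  obtains k where "k < 2 ^ p" "tensor_vec (A \<omega>) = row (sylvester p) k"
  using tensor_vec_is_sylvester_row measurable_space[OF A assms] by auto

lemma measurable_tensor [measurable]:
  "(\<lambda>\<omega>. g (tensor_vec (A \<omega>))) \<in> borel_measurable M"
  by (rule measurable_compose[OF A]) simp

text \<open>The tensor vector takes its values among finitely many rows, so the sum of \<bar>g\<bar>
  over all rows is a bound.\<close>

lemma integrable_tensor:
  fixes g :: "real vec \<Rightarrow> real"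
  shows "integrable M (\<lambda>\<omega>. g (tensor_vec (A \<omega>)))"
proof (rule integrable_const_bound)
  show "AE \<omega> in M. norm (g (tensor_vec (A \<omega>))) \<le> (\<Sum>k<2 ^ p. \<bar>g (row (sylvester p) k)\<bar>)"
  proof (rule AE_I2)
    fix \<omega> assume "\<omega> \<in> space M"
    then obtain k where "k < 2 ^ p" "tensor_vec (A \<omega>) = row (sylvester p) k"
      by (rule tensor_row)
    then show "norm (g (tensor_vec (A \<omega>))) \<le> (\<Sum>k<2 ^ p. \<bar>g (row (sylvester p) k)\<bar>)"
      using member_le_sum[of k "{..<2 ^ p}" "\<lambda>k. \<bar>g (row (sylvester p) k)\<bar>"] by simp
  qed
qed simp

text \<open>If the row were missed almost surely, then testing positive definiteness on the row itself
  would give 0, because it is orthogonal to all other values of the tensor vector.\<close>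

lemma tensor_hits_row:
  assumes pd: "pos_def_mat (second_moment_mat M (2 ^ p) (\<lambda>\<omega>. tensor_vec (A \<omega>)))"
    and k: "k < 2 ^ p" and P: "AE \<omega> in M. P \<omega>"
  shows "\<exists>\<omega>\<in>space M. tensor_vec (A \<omega>) = row (sylvester p) k \<and> P \<omega>"
proof (rule ccontr)
  assume none: "\<not> ?thesis"
  let ?r = "row (sylvester p) k"
  have "AE \<omega> in M. (?r \<bullet> tensor_vec (A \<omega>))\<^sup>2 = 0"
    using P
  proof (rule AE_mp, intro AE_I2 impI)
    fix \<omega> assume \<omega>: "\<omega> \<in> space M" "P \<omega>"
    obtain j where "j < 2 ^ p" "tensor_vec (A \<omega>) = row (sylvester p) j"
      using \<omega>(1) by (rule tensor_row)
    moreover from this have "j \<noteq> k"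
      using none \<omega> by auto
    ultimately show "(?r \<bullet> tensor_vec (A \<omega>))\<^sup>2 = 0"
      using k by (simp add: sylvester_row_orthogonal)
  qed
  then have "(\<integral>\<omega>. (?r \<bullet> tensor_vec (A \<omega>))\<^sup>2 \<partial>M) = 0"
    by (rule integral_eq_zero_AE)
  moreover have "?r \<bullet> (second_moment_mat M (2 ^ p) (\<lambda>\<omega>. tensor_vec (A \<omega>)) *\<^sub>v ?r) =
      (\<integral>\<omega>. (?r \<bullet> tensor_vec (A \<omega>))\<^sup>2 \<partial>M)"
  proof (rule second_moment_quadratic_form)
    show "integrable M (\<lambda>\<omega>. tensor_vec (A \<omega>) $ i * tensor_vec (A \<omega>) $ j)" for i j
      by (rule integrable_tensor)
    show "tensor_vec (A \<omega>) \<in> carrier_vec (2 ^ p)" if "\<omega> \<in> space M" for \<omega>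
      using that by (rule tensor_row) simp
  qed simp
  \<comment> \<open>A nonzero test vector makes the quadratic form strictly positive, against the
    value 0 just computed.\<close>
  moreover have "?r \<noteq> 0\<^sub>v (2 ^ p)"
  proof
    assume "?r = 0\<^sub>v (2 ^ p)"
    then have "?r \<bullet> ?r = 0"
      by (simp add: scalar_prod_left_zero[of _ "2 ^ p"])
    then show False
      using k by (simp add: sylvester_row_orthogonal)
  qed
  ultimately show False
    using pd by (auto simp: pos_def_mat_def second_moment_mat_def dest!: bspec[where x = ?r])
qed

text \<open>Every row is attained at some point outside the exceptional null set, so an almost sure
  property passes to each row. Conversely, every value of the tensor vector is a row.\<close>

lemma AE_tensor_iff:
  assumes "pos_def_mat (second_moment_mat M (2 ^ p) (\<lambda>\<omega>. tensor_vec (A \<omega>)))"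
  shows "(AE \<omega> in M. Q (tensor_vec (A \<omega>))) \<longleftrightarrow> (\<forall>k<2 ^ p. Q (row (sylvester p) k))"
proof
  assume "AE \<omega> in M. Q (tensor_vec (A \<omega>))"
  then show "\<forall>k<2 ^ p. Q (row (sylvester p) k)"
    using tensor_hits_row[OF assms] by metis
next
  assume "\<forall>k<2 ^ p. Q (row (sylvester p) k)"
  then show "AE \<omega> in M. Q (tensor_vec (A \<omega>))"
    by (intro AE_I2) (metis tensor_row)
qed

section \<open>Conditional expectation of a sign variable\<close>

abbreviation sigma_A :: "'a measure" where
  "sigma_A \<equiv> vimage_algebra (space M) A (count_space (sign_vecs p))"

lemma subalgebra_sigma_A: "subalgebra M sigma_A"
proof -
  have "A \<in> space M \<rightarrow> space (count_space (sign_vecs p))"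
    using measurable_space[OF A] by blast
  then show ?thesis
    using measurable_sets[OF A] by (auto simp: subalgebra_def sets_vimage_algebra2)
qed

sublocale finite_measure_subalgebra M sigma_A
  by unfold_locales (rule subalgebra_sigma_A)

text \<open>This permits functions of the tensor vector to be moved through the conditional
  expectation given A.\<close>

lemma measurable_tensor_sigma_A:
  "(\<lambda>\<omega>. g (tensor_vec (A \<omega>))) \<in> borel_measurable sigma_A"
proof -
  have "A \<in> measurable sigma_A (count_space (sign_vecs p))"
    by (rule measurable_vimage_algebra1) (use measurable_space[OF A] in auto)
  then show ?thesis
    by (rule measurable_compose) simp
qed

lemma integrable_sign:
  assumes "B \<in> measurable M (count_space {-1, 1 :: real})"
  shows "integrable M B"
proof (rule integrable_const_bound[where B = 1])
  show "AE \<omega> in M. norm (B \<omega>) \<le> 1"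
    using measurable_space[OF assms] by (intro AE_I2) force
  show "B \<in> borel_measurable M"
    using measurable_compose[OF assms, of "\<lambda>x. x" borel] by simp
qed

lemma cond_exp_sign_bound:
  assumes "B \<in> measurable M (count_space {-1, 1})"
  shows "AE \<omega> in M. \<bar>real_cond_exp M sigma_A B \<omega>\<bar> \<le> 1"
proof -
  note int = integrable_sign[OF assms]
  have B: "B \<omega> = 1 \<or> B \<omega> = - 1" if "\<omega> \<in> space M" for \<omega>
    using measurable_space[OF assms that] by auto
  have "AE \<omega> in M. real_cond_exp M sigma_A B \<omega> \<le> 1"
    by (rule real_cond_exp_le_c[OF int]) (use B in \<open>force intro!: AE_I2\<close>)
  moreover have "AE \<omega> in M. real_cond_exp M sigma_A B \<omega> \<ge> - 1"
    by (rule real_cond_exp_ge_c[OF int]) (use B in \<open>force intro!: AE_I2\<close>)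
  ultimately show ?thesis
    by eventually_elim auto
qed

text \<open>Let F be the value of f at the tensor vector. Then E[F B] = E[F E[B | A]] = E[F * F] =
  1, and since B and F are signs, E[(B - F)^2] = 2 - 2 E[F B] = 0.\<close>

lemma sign_eq_cond_exp:
  assumes Bm: "B \<in> measurable M (count_space {-1, 1})"
    and ce: "AE \<omega> in M. real_cond_exp M sigma_A B \<omega> = f (tensor_vec (A \<omega>))"
    and one: "AE \<omega> in M. \<bar>f (tensor_vec (A \<omega>))\<bar> = 1"
  shows "AE \<omega> in M. B \<omega> = f (tensor_vec (A \<omega>))"
proof -
  define F where "F = (\<lambda>\<omega>. f (tensor_vec (A \<omega>)))"
  have B: "B \<omega> = 1 \<or> B \<omega> = - 1" if "\<omega> \<in> space M" for \<omega>
    using measurable_space[OF Bm that] by auto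
  note int = integrable_sign[OF Bm]
  have [measurable]: "B \<in> borel_measurable M" "F \<in> borel_measurable M"
    using int by (auto simp: F_def)
  have FB: "integrable M (\<lambda>\<omega>. F \<omega> * B \<omega>)"
  proof (rule integrable_const_bound[where B = 1])
    show "AE \<omega> in M. norm (F \<omega> * B \<omega>) \<le> 1"
      using one AE_space by eventually_elim (use B in \<open>force simp: F_def abs_mult\<close>)
  qed simp
  have "(\<integral>\<omega>. F \<omega> * B \<omega> \<partial>M) = (\<integral>\<omega>. F \<omega> * real_cond_exp M sigma_A B \<omega> \<partial>M)"
    unfolding F_def
    by (rule real_cond_exp_intg(2)[symmetric]) (use FB measurable_tensor_sigma_A in \<open>auto simp: F_def\<close>)
  also have "\<dots> = (\<integral>\<omega>. 1 \<partial>M)"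
  proof (rule integral_cong_AE)
    show "AE \<omega> in M. F \<omega> * real_cond_exp M sigma_A B \<omega> = 1"
      using ce one by eventually_elim (auto simp: F_def abs_if split: if_splits)
  qed simp_all
  finally have FB1: "(\<integral>\<omega>. F \<omega> * B \<omega> \<partial>M) = 1"
    by (simp add: prob_space)
  have sq: "AE \<omega> in M. (B \<omega> - F \<omega>)\<^sup>2 = 2 - 2 * (F \<omega> * B \<omega>)"
    using one AE_space
  proof eventually_elim
    case (elim \<omega>)
    have "F \<omega> = 1 \<or> F \<omega> = - 1"
      using elim by (auto simp: F_def abs_if split: if_splits)
    then show ?case
      using B[OF elim(2)] by auto
  qed
  have intd: "integrable M (\<lambda>\<omega>. 2 - 2 * (F \<omega> * B \<omega>))"
    using FB by simp
  have "(\<integral>\<omega>. 2 - 2 * (F \<omega> * B \<omega>) \<partial>M) = 0"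
    using FB FB1 by (simp add: prob_space)
  moreover have "AE \<omega> in M. 0 \<le> 2 - 2 * (F \<omega> * B \<omega>)"
    using sq by eventually_elim (metis zero_le_power2)
  \<comment> \<open>A nonnegative integrand with integral 0 vanishes almost surely; it equals (B -
    F)^2 almost surely, so B = F.\<close>
  ultimately have "AE \<omega> in M. 2 - 2 * (F \<omega> * B \<omega>) = 0"
    using integral_nonneg_eq_0_iff_AE[OF intd] by blast
  with sq show ?thesis
    by eventually_elim (simp add: F_def)
qed

end

section \<open>Equivalence of the three conditions\<close>

theorem theorem4p4:
  fixes M :: "'a measure" and p :: nat
    and A :: "'a \<Rightarrow> real vec" and B :: "'a \<Rightarrow> real" and \<beta> :: "real vec"
  assumes "prob_space M"
    and "A \<in> measurable M (count_space (sign_vecs p))"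
    and "B \<in> measurable M (count_space {-1, 1})"
    and "pos_def_mat (second_moment_mat M (2 ^ p) (\<lambda>\<omega>. tensor_vec (A \<omega>)))"
    and "\<beta> \<in> carrier_vec (2 ^ p)"
    and "AE \<omega> in M. cond_exp_given M (sign_vecs p) A B \<omega> = \<beta> \<bullet> tensor_vec (A \<omega>)"
  shows "(l2_norm \<beta> = 1 \<longleftrightarrow> vertex_of \<beta> (hadamard_cube p)) \<and>
    (vertex_of \<beta> (hadamard_cube p) \<longleftrightarrow>
       (AE \<omega> in M. B \<omega> = cond_exp_given M (sign_vecs p) A B \<omega> \<and>
                   cond_exp_given M (sign_vecs p) A B \<omega> = \<beta> \<bullet> tensor_vec (A \<omega>))) \<and>
    ((AE \<omega> in M. B \<omega> = cond_exp_given M (sign_vecs p) A B \<omega> \<and>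
                 cond_exp_given M (sign_vecs p) A B \<omega> = \<beta> \<bullet> tensor_vec (A \<omega>)) \<longrightarrow>
       prob_space.variance M B = prob_space.variance M (\<lambda>\<omega>. \<beta> \<bullet> tensor_vec (A \<omega>)) \<and>
       prob_space.variance M (\<lambda>\<omega>. \<beta> \<bullet> tensor_vec (A \<omega>)) =
         prob_space.variance M (cond_exp_given M (sign_vecs p) A B))"
proof -
  interpret random_signs M p A
    using assms(1,2) by (simp add: random_signs_def random_signs_axioms_def)
  note pd = assms(4)
  define E where "E = cond_exp_given M (sign_vecs p) A B"
  have E_eq: "E = real_cond_exp M sigma_A B"
    by (simp add: E_def cond_exp_given_def)
  have ce: "AE \<omega> in M. E \<omega> = \<beta> \<bullet> tensor_vec (A \<omega>)"
    using assms(6) by (simp add: E_def)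
  \<comment> \<open>The entries of H\<beta> are the values of the linear form \<beta> at the rows,
    which links the cube to E[B | A].\<close>
  have entry: "(sylvester p *\<^sub>v \<beta>) $ k = \<beta> \<bullet> row (sylvester p) k" if "k < 2 ^ p" for k
    using that assms(5) by (simp add: comm_scalar_prod[of _ "2 ^ p"])
  \<comment> \<open>The bound on E[B | A] carries over to every row and puts \<beta> in the cube,
    where the norm and vertex criteria apply.\<close>
  have "AE \<omega> in M. \<bar>\<beta> \<bullet> tensor_vec (A \<omega>)\<bar> \<le> 1"
    using ce cond_exp_sign_bound[OF assms(3)] by eventually_elim (simp add: E_eq)
  then have "\<forall>k<2 ^ p. \<bar>\<beta> \<bullet> row (sylvester p) k\<bar> \<le> 1"
    using AE_tensor_iff[OF pd, of "\<lambda>v. \<bar>\<beta> \<bullet> v\<bar> \<le> 1"] by simp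
  then have cube: "\<beta> \<in> hadamard_cube p"
    using assms(5) by (simp add: hadamard_cube_iff entry del: index_mult_mat_vec)
  have ext: "(\<forall>k<2 ^ p. \<bar>(sylvester p *\<^sub>v \<beta>) $ k\<bar> = 1) \<longleftrightarrow> (AE \<omega> in M. \<bar>\<beta> \<bullet> tensor_vec (A \<omega>)\<bar> = 1)"
    using AE_tensor_iff[OF pd, of "\<lambda>v. \<bar>\<beta> \<bullet> v\<bar> = 1"] by (simp add: entry del: index_mult_mat_vec)
  \<comment> \<open>If the linear form has absolute value 1, it determines B by
    \<open>sign_eq_cond_exp\<close>; conversely, it inherits absolute value 1 from B.\<close>
  have det: "(AE \<omega> in M. \<bar>\<beta> \<bullet> tensor_vec (A \<omega>)\<bar> = 1) \<longleftrightarrow>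
      (AE \<omega> in M. B \<omega> = E \<omega> \<and> E \<omega> = \<beta> \<bullet> tensor_vec (A \<omega>))"
  proof
    assume "AE \<omega> in M. \<bar>\<beta> \<bullet> tensor_vec (A \<omega>)\<bar> = 1"
    then have "AE \<omega> in M. B \<omega> = \<beta> \<bullet> tensor_vec (A \<omega>)"
      using sign_eq_cond_exp[OF assms(3), of "\<lambda>v. \<beta> \<bullet> v"] ce by (simp add: E_eq)
    with ce show "AE \<omega> in M. B \<omega> = E \<omega> \<and> E \<omega> = \<beta> \<bullet> tensor_vec (A \<omega>)"
      by eventually_elim simp
  next
    assume "AE \<omega> in M. B \<omega> = E \<omega> \<and> E \<omega> = \<beta> \<bullet> tensor_vec (A \<omega>)"
    with AE_space show "AE \<omega> in M. \<bar>\<beta> \<bullet> tensor_vec (A \<omega>)\<bar> = 1"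
    proof eventually_elim
      case (elim \<omega>)
      then show ?case
        using measurable_space[OF assms(3), of \<omega>] by auto
    qed
  qed
  have variance_cong: "variance X = variance Y"
    if "AE \<omega> in M. X \<omega> = Y \<omega>" and [measurable]: "X \<in> borel_measurable M" "Y \<in> borel_measurable M"
    for X Y :: "'a \<Rightarrow> real"
  proof -
    \<comment> \<open>The mean also occurs inside the variance integrand, so it is replaced
      first.\<close>
    have "expectation X = expectation Y"
      using that by (intro integral_cong_AE) auto
    then show ?thesis
      using that by (intro integral_cong_AE) auto
  qed
  have var: "variance B = variance (\<lambda>\<omega>. \<beta> \<bullet> tensor_vec (A \<omega>)) \<and>
      variance (\<lambda>\<omega>. \<beta> \<bullet> tensor_vec (A \<omega>)) = variance E"
    if "AE \<omega> in M. B \<omega> = E \<omega> \<and> E \<omega> = \<beta> \<bullet> tensor_vec (A \<omega>)"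
  proof (intro conjI variance_cong)
    show "AE \<omega> in M. B \<omega> = \<beta> \<bullet> tensor_vec (A \<omega>)" "AE \<omega> in M. \<beta> \<bullet> tensor_vec (A \<omega>) = E \<omega>"
      using that by auto
  qed (use integrable_sign[OF assms(3)] in \<open>auto simp: E_eq\<close>)
  show ?thesis
    using l2_norm_eq_1_iff[OF cube] vertex_hadamard_cube_iff[OF cube] ext det var
    unfolding E_def by blast
qed

end
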